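(* Let $p$ be a positive and differentiable function on an open interval $(a,b)\subset\mathbb{R}$, let $f$ be a continuous real-valued function on a domain $D\subset\mathbb{R}^2$, and let $x_0$ be any point of $(a,b)$. Then the change of independent variable $$t=\int_{x_0}^{x}\frac{d\xi}{\sqrt{p(\xi)}}$$ transforms the differential equation $$p(x)\,y''(x)+\tfrac12\,p'(x)\,y'(x)+f\bigl(\sqrt{p(x)}\,y'(x),\,y(x)\bigr)=0$$ into the second order differential equation $$y''(t)+f\bigl(y'(t),\,y(t)\bigr)=0 .$$
   Context: In the first equation primes denote derivatives with respect to $x$; in the second they denote derivatives with respect to $t$, and $y(t)$ denotes the unknown function expressed in the new variable. "Transforms" means the following. Let $T(x)=\int_{x_0}^{x}\frac{d\xi}{\sqrt{p(\xi)}}$ for $x\in(a,b)$. For every open subinterval $J\subset(a,b)$ and every twice differentiable function $y:J\to\mathbb{R}$ with $(\sqrt{p(x)}\,y'(x),y(x))\in D$ for all $x\in J$, set $Y(t)=y(T^{-1}(t))$ for $t\in T(J)$. Then $y$ satisfies the first equation on $J$ if and only if $Y$ is twice differentiable and satisfies $Y''(t)+f(Y'(t),Y(t))=0$ on $T(J)$. *)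

theory Defs
  imports "HOL-Analysis.Analysis"
begin

text \<open>The integral is the oriented one, so that the value is negative for \<open>x < x0\<close>.\<close>

definition new_variable :: "(real \<Rightarrow> real) \<Rightarrow> real \<Rightarrow> real \<Rightarrow> real" where
  "new_variable p x0 x = (LBINT \<xi>=ereal x0..ereal x. 1 / sqrt (p \<xi>))"

text \<open>The predicates below are meant for open \<open>S\<close>, where \<^const>\<open>deriv\<close> depends only on the
  values of the function on \<open>S\<close>.\<close>

definition twice_differentiable_on :: "(real \<Rightarrow> real) \<Rightarrow> real set \<Rightarrow> bool"
    (infix \<open>twice'_differentiable'_on\<close> 50) where
  "g twice_differentiable_on S \<longleftrightarrow> g differentiable_on S \<and> deriv g differentiable_on S"

text \<open>The function \<open>f\<close> is only given on \<open>D\<close>, hence satisfying an equation that contains a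
  value of \<open>f\<close> includes that its argument lies in \<open>D\<close>.\<close>

definition satisfies_original ::
  "(real \<Rightarrow> real) \<Rightarrow> (real \<times> real \<Rightarrow> real) \<Rightarrow> (real \<times> real) set \<Rightarrow> (real \<Rightarrow> real) \<Rightarrow> real set \<Rightarrow> bool" where
  "satisfies_original p f D y S \<longleftrightarrow>
     (\<forall>x\<in>S. (sqrt (p x) * deriv y x, y x) \<in> D \<and>
        p x * deriv (deriv y) x + 1/2 * deriv p x * deriv y x
          + f (sqrt (p x) * deriv y x, y x) = 0)"

definition satisfies_transformed ::
  "(real \<times> real \<Rightarrow> real) \<Rightarrow> (real \<times> real) set \<Rightarrow> (real \<Rightarrow> real) \<Rightarrow> real set \<Rightarrow> bool" where
  "satisfies_transformed f D Y S \<longleftrightarrow>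
     (\<forall>t\<in>S. (deriv Y t, Y t) \<in> D \<and> deriv (deriv Y) t + f (deriv Y t, Y t) = 0)"

end

theory Submission
  imports Defs
begin

text \<open>Write \<open>T\<close> for the change of variable. Since \<open>T' = 1 / sqrt p > 0\<close>, its inverse has derivative
  \<open>sqrt p\<close>, so differentiating with respect to \<open>t\<close> amounts to applying \<open>sqrt p * d/dx\<close>. Hence
  \<open>dY/dt = sqrt p * y'\<close>, and a second application gives \<open>p * y'' + p' * y' / 2\<close>.\<close>

lemma new_variable_has_real_derivative:
  fixes p :: "real \<Rightarrow> real"
  assumes "\<And>x. x \<in> einterval a b \<Longrightarrow> p x > 0" and "continuous_on (einterval a b) p"
    and "x0 \<in> einterval a b" and "x \<in> einterval a b"
  shows "(new_variable p x0 has_real_derivative 1 / sqrt (p x)) (at x)"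
proof -
  have cont: "continuous_on (einterval a b) (\<lambda>\<xi>. 1 / sqrt (p \<xi>))"
    using assms(1) by (intro continuous_intros assms(2)) (auto dest: less_imp_neq[OF assms(1)])
  \<comment> \<open>The fundamental theorem of calculus is applied on a compact interval and gives a
    derivative relative to it. Choosing \<open>c\<close> and \<open>d\<close> strictly beyond both
    \<open>x0\<close> and \<open>x\<close> puts \<open>x\<close> in the interior, so the derivative
    becomes two-sided. The oriented integral covers both orders of \<open>x0\<close> and
    \<open>x\<close>.\<close>
  have "a < ereal (min x0 x)" "ereal (max x0 x) < b"
    using assms(3,4) by (auto simp: einterval_def min_def max_def)
  then obtain c d where c: "a < ereal c" "c < min x0 x" and d: "max x0 x < d" "ereal d < b"
    using ereal_dense2[of a "ereal (min x0 x)"] ereal_dense2[of "ereal (max x0 x)" b] by auto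
  then have "{c..d} \<subseteq> einterval a b"
    by (auto simp: einterval_def intro: less_le_trans[of a "ereal c"] le_less_trans[of _ "ereal d"])
  with cont have "continuous_on {c..d} (\<lambda>\<xi>. 1 / sqrt (p \<xi>))"
    by (rule continuous_on_subset)
  then have "((\<lambda>u. LBINT \<xi>=ereal x0..ereal u. 1 / sqrt (p \<xi>)) has_vector_derivative 1 / sqrt (p x))
      (at x within {c..d})"
    using c d by (intro interval_integral_FTC2) auto
  moreover have "at x within {c..d} = at x"
    using c d by (intro at_within_interior) auto
  ultimately show ?thesis
    by (simp add: new_variable_def[abs_def] has_real_derivative_iff_has_vector_derivative)
qed

lemma deriv_pos_imp_strict_mono_on:
  fixes T :: "real \<Rightarrow> real"
  assumes "is_interval I" and "\<And>x. x \<in> I \<Longrightarrow> (T has_real_derivative T' x) (at x)"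
    and "\<And>x. x \<in> I \<Longrightarrow> T' x > 0"
  shows "strict_mono_on I T"
proof (rule strict_mono_onI)
  fix x z assume *: "x \<in> I" "z \<in> I" "x < z"
  show "T x < T z"
    using *(3)
  proof (rule DERIV_pos_imp_increasing)
    fix u assume "x \<le> u" "u \<le> z"
    then have "u \<in> I" using assms(1) * by (meson is_interval_1)
    then show "\<exists>D. (T has_real_derivative D) (at u) \<and> D > 0"
      using assms(2,3) by blast
  qed
qed

text \<open>Continuity and injectivity on an open set make the inverse continuous, by invariance of
  domain. Hence a nonzero derivative at the single point \<open>x\<close> suffices for
  differentiating the inverse at \<open>T x\<close>.\<close>

lemma the_inv_into_has_real_derivative:
  fixes T :: "real \<Rightarrow> real"
  assumes "open I" and "inj_on T I" and "continuous_on I T" and "x \<in> I"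
    and "(T has_real_derivative D) (at x)" and "D \<noteq> 0"
  shows "(the_inv_into I T has_real_derivative inverse D) (at (T x))"
  unfolding has_field_derivative_def
proof (rule has_derivative_inverse_strong[OF assms(1,4,3)])
  show "(T has_derivative (*) D) (at x)"
    using assms(5) by (simp add: has_field_derivative_def)
qed (use assms(2,6) in \<open>auto simp: the_inv_into_f_f fun_eq_iff\<close>)

text \<open>This replaces iterated \<open>deriv\<close> by explicit formulas. The formula
  \<open>g'\<close> agrees with \<open>deriv g\<close> only on \<open>S\<close>, but since
  \<open>S\<close> is open they agree near each of its points and so have the same derivative
  there.\<close>

lemma twice_differentiable_on_of_derivatives:
  assumes "open S"
    and g': "\<And>t. t \<in> S \<Longrightarrow> (g has_real_derivative g' t) (at t)"
    and g'': "\<And>t. t \<in> S \<Longrightarrow> (g' has_real_derivative g'' t) (at t)"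
  shows "g twice_differentiable_on S"
    and "\<And>t. t \<in> S \<Longrightarrow> deriv g t = g' t"
    and "\<And>t. t \<in> S \<Longrightarrow> deriv (deriv g) t = g'' t"
proof -
  show eq: "deriv g t = g' t" if "t \<in> S" for t
    using g'[OF that] by (rule DERIV_imp_deriv)
  have deriv2: "(deriv g has_real_derivative g'' t) (at t)" if "t \<in> S" for t
    using g''[OF that] \<open>open S\<close> that by (rule has_field_derivative_transform_within_open) (simp add: eq)
  then show "deriv (deriv g) t = g'' t" if "t \<in> S" for t
    using that by (blast intro: DERIV_imp_deriv)
  show "g twice_differentiable_on S"
    unfolding twice_differentiable_on_def differentiable_on_def
    using g' deriv2
    by (meson field_differentiable_def field_differentiable_imp_differentiable
        differentiable_at_withinI)
qed

theorem theorem2p1: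
  fixes p :: "real \<Rightarrow> real" and f :: "real \<times> real \<Rightarrow> real" and D :: "(real \<times> real) set"
    and a b :: ereal and x0 :: real
  assumes "\<And>x. x \<in> einterval a b \<Longrightarrow> p x > 0"
    and "p differentiable_on einterval a b"
    and "open D" and "connected D" and "D \<noteq> {}"
    and "continuous_on D f"
    and "x0 \<in> einterval a b"
  shows "\<forall>J y. open J \<and> is_interval J \<and> J \<subseteq> einterval a b \<and> y twice_differentiable_on J
           \<and> (\<forall>x\<in>J. (sqrt (p x) * deriv y x, y x) \<in> D) \<longrightarrow>
         (let T = new_variable p x0;
              Y = (\<lambda>t. y (the_inv_into (einterval a b) T t))
          in satisfies_original p f D y J \<longleftrightarrow>
             Y twice_differentiable_on (T ` J) \<and> satisfies_transformed f D Y (T ` J))"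
proof (intro allI impI, elim conjE)
  fix J y
  assume J: "open J" "is_interval J" "J \<subseteq> einterval a b" and y: "y twice_differentiable_on J"
    and D: "\<forall>x\<in>J. (sqrt (p x) * deriv y x, y x) \<in> D"
  let ?I = "einterval a b"
  define T where "T = new_variable p x0"
  define G where "G = the_inv_into ?I T"
  define Y where "Y = (\<lambda>t. y (G t))"
  have "open ?I"
    by simp
  have "is_interval ?I"
    unfolding is_interval_1 Ball_def einterval_iff
    by (meson ereal_less_eq(3) le_less_trans less_le_trans)
  have T': "(T has_real_derivative 1 / sqrt (p x)) (at x)" if "x \<in> ?I" for x
    unfolding T_def using assms that
    by (intro new_variable_has_real_derivative) (auto intro: differentiable_imp_continuous_on)
  have contT: "continuous_on ?I T"
    using T' by (meson DERIV_continuous_on has_field_derivative_at_within)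
  have injT: "inj_on T ?I"
    using \<open>is_interval ?I\<close> T' assms(1)
    by (intro strict_mono_on_imp_inj_on deriv_pos_imp_strict_mono_on[where T' = "\<lambda>x. 1 / sqrt (p x)"]) auto
  have GT: "G (T x) = x" if "x \<in> J" for x
    using that J(3) injT by (auto simp: G_def the_inv_into_f_f)
  have G': "(G has_real_derivative sqrt (p x)) (at (T x))" if "x \<in> J" for x
  proof -
    have "x \<in> ?I" using that J(3) by blast
    from the_inv_into_has_real_derivative[OF \<open>open ?I\<close> injT contT this T'[OF this]] assms(1)[OF this]
    show ?thesis by (simp add: G_def)
  qed
  have "open (T ` J)"
    using J(1,3) contT injT
    by (intro invariance_of_domain) (auto intro: continuous_on_subset inj_on_subset)
  have y': "(y has_real_derivative deriv y x) (at x)"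
    and y'': "(deriv y has_real_derivative deriv (deriv y) x) (at x)" if "x \<in> J" for x
    using y that J(1) unfolding twice_differentiable_on_def
    by (auto simp: differentiable_on_eq_differentiable_at DERIV_deriv_iff_real_differentiable)
  have p': "(p has_real_derivative deriv p x) (at x)" if "x \<in> J" for x
    using assms(2) that J(3) \<open>open ?I\<close>
    by (auto simp: differentiable_on_eq_differentiable_at DERIV_deriv_iff_real_differentiable)
  \<comment> \<open>At \<open>t = T x\<close>, \<open>?Y'\<close> is the first argument of
    \<open>f\<close> in the original equation and \<open>?Y''\<close> is that equation's left side
    without the \<open>f\<close> term.\<close>
  let ?Y' = "\<lambda>t. sqrt (p (G t)) * deriv y (G t)"
  let ?Y'' = "\<lambda>t. p (G t) * deriv (deriv y) (G t) + 1/2 * deriv p (G t) * deriv y (G t)"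
  have Y': "(Y has_real_derivative ?Y' t) (at t)" if "t \<in> T ` J" for t
  proof -
    from that obtain x where x: "x \<in> J" "t = T x" by blast
    from DERIV_chain2[OF _ G'[OF x(1)], of y] y'[OF x(1)] show ?thesis
      by (simp add: Y_def x GT mult.commute)
  qed
  have Y'': "(?Y' has_real_derivative ?Y'' t) (at t)" if "t \<in> T ` J" for t
  proof -
    from that obtain x where x: "x \<in> J" "t = T x" by blast
    have pos: "p x > 0" using assms(1) x J(3) by blast
    have "((\<lambda>x. sqrt (p x)) has_real_derivative deriv p x / (2 * sqrt (p x))) (at x)"
      using pos by (auto intro!: derivative_eq_intros p'[OF x(1)] simp: field_simps)
    then have "((\<lambda>x. sqrt (p x) * deriv y x) has_real_derivative
        deriv p x / (2 * sqrt (p x)) * deriv y x + deriv (deriv y) x * sqrt (p x)) (at x)"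
      using y''[OF x(1)] by (rule DERIV_mult)
    then have "(?Y' has_real_derivative
        (deriv p x / (2 * sqrt (p x)) * deriv y x + deriv (deriv y) x * sqrt (p x)) * sqrt (p x)) (at t)"
      using DERIV_chain2[OF _ G'[OF x(1)], of "\<lambda>x. sqrt (p x) * deriv y x"] by (simp add: x GT)
    \<comment> \<open>The outer factor \<open>sqrt (p x)\<close>, which is \<open>dx/dt\<close>,
      cancels the denominator left by differentiating the root and turns the other
      \<open>sqrt (p x)\<close> into \<open>p x\<close>.\<close>
    moreover have "(deriv p x / (2 * sqrt (p x)) * deriv y x + deriv (deriv y) x * sqrt (p x)) * sqrt (p x)
        = ?Y'' t"
      using pos by (simp add: x GT field_simps)
    ultimately show ?thesis by simp
  qed
  note Y = twice_differentiable_on_of_derivatives[OF \<open>open (T ` J)\<close> Y' Y'']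
  \<comment> \<open>Under \<open>t = T x\<close> the two conditions coincide point by point,
    membership in \<open>D\<close> included. The differentiability of \<open>Y\<close> is already
    known from that of \<open>y\<close>, whether or not either equation holds.\<close>
  have "satisfies_transformed f D Y (T ` J) \<longleftrightarrow> satisfies_original p f D y J"
    unfolding satisfies_transformed_def satisfies_original_def
    using Y(2,3) by (simp add: Y_def GT)
  then show "let T = new_variable p x0; Y = (\<lambda>t. y (the_inv_into ?I T t))
      in satisfies_original p f D y J \<longleftrightarrow>
         Y twice_differentiable_on (T ` J) \<and> satisfies_transformed f D Y (T ` J)"
    using Y(1) by (simp add: Let_def Y_def G_def T_def)
qed

end
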